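(* Fix $1<q\le\infty$ and let $q'$ be its conjugate exponent. Suppose that the Banach space $X$ has a basis $\{x_n\}$ with the property that each blocking of this basis satisfies an upper $q$-estimate. Then for each $q'\le p\le\infty$, $X$ enjoys property $(D_p)$: every $L_p(X)$-bounded sequence of functions that converges scalarly in measure (to some $f\in L_0(X)$) has a subsequence that converges scalarly a.e.
   Context: $(\Omega,\Sigma,\mu)$ is the Lebesgue measure space on $[0,1]$. Banach spaces are real. $L_0(X)$ is the space of (classes of a.e. equal) strongly measurable functions $f:\Omega\to X$, and $L_p(X)$ are the Bochner–Lebesgue spaces. For $f_n,f\in L_0(X)$, $\{f_n\}$ converges scalarly a.e. (resp. scalarly in measure) to $f$ if for each $x^*\in X^*$, $x^*f_n\to x^*f$ almost everywhere, with exceptional null set possibly depending on $x^*$ (resp. in measure). A sequence is $L_p(X)$-bounded if $\sup_n\|f_n\|_{L_p(X)}<\infty$. "Basis" means Schauder basis. A blocking of a basis (or basic sequence) $\{x_n\}$ is a sequence $\{X_k\}$ of finite-dimensional subspaces for which there is a strictly increasing sequence of integers $\{n_k\}$ with $n_1=1$ such that $X_k$ is the span of $\{x_i: n_k\le i\le n_{k+1}-1\}$ for each $k$. For $1\le q\le\infty$, the blocking $\{X_k\}$ satisfies an upper $q$-estimate if there is a constant $c>0$ such that for every $n$ and every choice of $y_i\in X_i$ ($1\le i\le n$), $\left\|\sum_{i=1}^n y_i\right\|\le c\,\left\|(\|y_i\|)_{i=1}^n\right\|_{\ell_q}$. The conjugate exponent $q'$ satisfies $1/q+1/q'=1$, with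 $\infty'=1$. *)

theory Defs
  imports "HOL-Analysis.Analysis" "HOL-Probability.Essential_Supremum"
begin

text \<open>
  Exponents in \<open>[1, \<infinity>]\<close> are of type \<open>ennreal\<close>, with \<open>\<infinity>\<close> written as \<open>top\<close>.
  Bases, blockings and finite families are indexed from 0.
\<close>

abbreviation unit_interval :: "real measure" where
  "unit_interval \<equiv> lebesgue_on {0..1}"

text \<open>
  Bochner's notion: almost everywhere a limit of simple functions. Unlike Borel measurability,
  it is the right notion also when the type is not assumed to be second countable.
\<close>
definition strongly_measurable :: "'t measure \<Rightarrow> ('t \<Rightarrow> 'a::banach) \<Rightarrow> bool" where
  "strongly_measurable M f \<longleftrightarrow>
     (\<exists>s. (\<forall>n. simple_function M (s n)) \<and> (AE t in M. (\<lambda>n. s n t) \<longlonglongrightarrow> f t))"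

definition in_Lp :: "'t measure \<Rightarrow> ennreal \<Rightarrow> ('t \<Rightarrow> 'a::banach) \<Rightarrow> bool" where
  "in_Lp M p f \<longleftrightarrow> strongly_measurable M f \<and>
     (if p = top then \<exists>C. AE t in M. norm (f t) \<le> C
      else integrable M (\<lambda>t. norm (f t) powr enn2real p))"

text \<open>The following real number is the norm only of functions satisfying \<open>in_Lp M p\<close>.\<close>
definition Lp_norm :: "'t measure \<Rightarrow> ennreal \<Rightarrow> ('t \<Rightarrow> 'a::banach) \<Rightarrow> real" where
  "Lp_norm M p f =
     (if p = top then real_of_ereal (esssup M (\<lambda>t. ereal (norm (f t))))
      else (\<integral>t. norm (f t) powr enn2real p \<partial>M) powr (1 / enn2real p))"

definition Lp_bounded :: "'t measure \<Rightarrow> ennreal \<Rightarrow> (nat \<Rightarrow> 't \<Rightarrow> 'a::banach) \<Rightarrow> bool" where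
  "Lp_bounded M p f \<longleftrightarrow>
     (\<forall>n. in_Lp M p (f n)) \<and> bdd_above (range (\<lambda>n. Lp_norm M p (f n)))"

definition tendsto_in_measure :: "'t measure \<Rightarrow> (nat \<Rightarrow> 't \<Rightarrow> real) \<Rightarrow> ('t \<Rightarrow> real) \<Rightarrow> bool" where
  "tendsto_in_measure M g h \<longleftrightarrow>
     (\<forall>\<epsilon>>0. (\<lambda>n. measure M {t \<in> space M. \<bar>g n t - h t\<bar> > \<epsilon>}) \<longlonglongrightarrow> 0)"

definition scalarly_ae :: "'t measure \<Rightarrow> (nat \<Rightarrow> 't \<Rightarrow> 'a::banach) \<Rightarrow> ('t \<Rightarrow> 'a) \<Rightarrow> bool" where
  "scalarly_ae M f g \<longleftrightarrow>
     (\<forall>\<phi> :: 'a \<Rightarrow>\<^sub>L real. AE t in M. (\<lambda>n. \<phi> (f n t)) \<longlonglongrightarrow> \<phi> (g t))"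

definition scalarly_in_measure :: "'t measure \<Rightarrow> (nat \<Rightarrow> 't \<Rightarrow> 'a::banach) \<Rightarrow> ('t \<Rightarrow> 'a) \<Rightarrow> bool" where
  "scalarly_in_measure M f g \<longleftrightarrow>
     (\<forall>\<phi> :: 'a \<Rightarrow>\<^sub>L real. tendsto_in_measure M (\<lambda>n t. \<phi> (f n t)) (\<lambda>t. \<phi> (g t)))"

definition property_D :: "'a::banach itself \<Rightarrow> ennreal \<Rightarrow> bool" where
  "property_D _ p \<longleftrightarrow>
     (\<forall>(f :: nat \<Rightarrow> real \<Rightarrow> 'a) g.
        Lp_bounded unit_interval p f \<and> strongly_measurable unit_interval g \<and>
        scalarly_in_measure unit_interval f g \<longrightarrow>
        (\<exists>r. strict_mono r \<and> scalarly_ae unit_interval (\<lambda>n. f (r n)) g))"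

definition schauder_basis :: "(nat \<Rightarrow> 'a::banach) \<Rightarrow> bool" where
  "schauder_basis x \<longleftrightarrow> (\<forall>v. \<exists>!a :: nat \<Rightarrow> real. (\<lambda>n. a n *\<^sub>R x n) sums v)"

definition blocking :: "(nat \<Rightarrow> 'a::banach) \<Rightarrow> (nat \<Rightarrow> 'a set) \<Rightarrow> bool" where
  "blocking x B \<longleftrightarrow>
     (\<exists>m :: nat \<Rightarrow> nat. strict_mono m \<and> m 0 = 0 \<and> (\<forall>k. B k = span (x ` {m k..<m (Suc k)})))"

text \<open>The \<open>\<ell>\<^sub>q\<close> norm of the finite sequence \<open>a 0, \<dots>, a n\<close>.\<close>
definition lq_norm :: "ennreal \<Rightarrow> nat \<Rightarrow> (nat \<Rightarrow> real) \<Rightarrow> real" where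
  "lq_norm q n a =
     (if q = top then Max ((\<lambda>i. \<bar>a i\<bar>) ` {..n})
      else (\<Sum>i\<le>n. \<bar>a i\<bar> powr enn2real q) powr (1 / enn2real q))"

definition upper_estimate :: "ennreal \<Rightarrow> (nat \<Rightarrow> 'a::banach set) \<Rightarrow> bool" where
  "upper_estimate q B \<longleftrightarrow>
     (\<exists>c>0. \<forall>n y. (\<forall>i\<le>n. y i \<in> B i) \<longrightarrow>
        norm (\<Sum>i\<le>n. y i) \<le> c * lq_norm q n (\<lambda>i. norm (y i)))"

end

theory Submission
  imports Defs
begin

text \<open>
  Basis projections \<open>P N\<close> are uniformly bounded, by Baire category. Given \<open>f n\<close> tending to \<open>g\<close>
  scalarly in measure, choose alternately indices \<open>m k\<close> of the basis and \<open>r k\<close> of the sequence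
  such that, off sets of measure \<open>2\<^sup>-\<^sup>k\<close>, both \<open>P (m k) (f (r k) - g)\<close> and
  \<open>f (r k) - P (m (k + 1)) (f (r k))\<close> have norm at most \<open>2\<^sup>-\<^sup>k\<close>. By Borel--Cantelli both tend to 0
  almost everywhere. What remains of \<open>f (r k) - g\<close>, up to the tail of the expansion of \<open>g\<close>, is
  \<open>Q k (f (r k))\<close> with \<open>Q k = P (m (k + 1)) - P (m k)\<close>. The upper \<open>q\<close>-estimate of the blocking
  given by \<open>m\<close> dualizes to the \<open>q'\<close>-summability of the norms of \<open>\<phi> \<circ> Q k\<close>, for every functional
  \<open>\<phi>\<close>. As the \<open>L\<^sub>q\<^sub>'\<close> norms of the \<open>f n\<close> are bounded, the sum of \<open>\<bar>\<phi> (Q k (f (r k)))\<bar>\<close> to the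
  power \<open>q'\<close> is integrable, so its terms tend to 0 almost everywhere.
\<close>

section \<open>Uniform boundedness of the basis projections\<close>

definition coord :: "(nat \<Rightarrow> 'a::banach) \<Rightarrow> 'a \<Rightarrow> nat \<Rightarrow> real" where
  "coord x v = (THE a. (\<lambda>n. a n *\<^sub>R x n) sums v)"

definition basis_proj :: "(nat \<Rightarrow> 'a::banach) \<Rightarrow> nat \<Rightarrow> 'a \<Rightarrow> 'a" where
  "basis_proj x N v = (\<Sum>i<N. coord x v i *\<^sub>R x i)"

context
  fixes x :: "nat \<Rightarrow> 'a::banach"
  assumes basis: "schauder_basis x"
begin

lemma coord_sums: "(\<lambda>n. coord x v n *\<^sub>R x n) sums v"
  unfolding coord_def by (rule theI'[where P = "\<lambda>a. (\<lambda>n. a n *\<^sub>R x n) sums v"])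
     (use basis in \<open>simp add: schauder_basis_def\<close>)

lemma coord_unique: "(\<lambda>n. a n *\<^sub>R x n) sums v \<Longrightarrow> coord x v = a"
  using basis coord_sums[of v] unfolding schauder_basis_def by blast

lemma coord_add: "coord x (u + v) = (\<lambda>i. coord x u i + coord x v i)"
  by (rule coord_unique) (use sums_add[OF coord_sums coord_sums] in \<open>simp add: scaleR_add_left\<close>)

lemma coord_scaleR: "coord x (c *\<^sub>R v) = (\<lambda>i. c * coord x v i)"
  by (rule coord_unique) (use sums_scaleR_right[OF coord_sums, of c v] in simp)

text \<open>A zero basis vector would give the vector 0 two expansions. This permits dividing by
  \<open>norm (x i)\<close> in coordinate bounds.\<close>

lemma basis_nonzero: "x i \<noteq> 0"
proof
  assume "x i = 0"
  then have "(\<lambda>j. (if j = i then 1 else 0) *\<^sub>R x j) = (\<lambda>j. 0)"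
    by auto
  then have "coord x 0 = (\<lambda>j. if j = i then 1 else 0)"
    by (intro coord_unique) simp
  moreover have "coord x 0 = (\<lambda>j. 0)"
    by (intro coord_unique) simp
  ultimately show False
    by (metis zero_neq_one)
qed

lemma linear_basis_proj: "linear (basis_proj x N)"
  by (rule linearI)
     (simp_all add: basis_proj_def coord_add coord_scaleR scaleR_add_left sum.distrib scaleR_sum_right)

lemma basis_proj_tendsto: "(\<lambda>N. basis_proj x N v) \<longlonglongrightarrow> v"
  using coord_sums[of v] unfolding sums_def basis_proj_def .

lemma coord_scaleR_eq_diff: "coord x v i *\<^sub>R x i = basis_proj x (Suc i) v - basis_proj x i v"
  by (simp add: basis_proj_def)

text \<open>This is the Baire half of the boundedness proof. Convergent expansions are bounded, so
  the sets \<open>A m\<close> cover the space and the closure of one of them contains a ball.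
  Rescaling gives approximants with controlled projections; the factor 1/2 makes the approximation
  iterable.\<close>

lemma basis_proj_dense_bound:
  obtains C where "C \<ge> 0"
    "\<And>w. \<exists>a. norm (w - a) \<le> norm w / 2 \<and> (\<forall>N. norm (basis_proj x N a) \<le> C * norm w)"
proof -
  interpret P: linear "basis_proj x N" for N by (rule linear_basis_proj)
  \<comment> \<open>Continuity of the projections is not yet available, so \<open>A m\<close> is not
    known to be closed. Baire is therefore applied to the closures.\<close>
  define A where "A m = {v. \<forall>N. norm (basis_proj x N v) \<le> real m}" for m
  have "\<exists>m. interior (closure (A m)) \<noteq> {}"
  proof (rule ccontr)
    assume "\<not> ?thesis"
    then have "euclidean interior_of (\<Union>(range (\<lambda>m. closure (A m)))) = {}"
      by (intro Baire_category_alt) (auto simp: completely_metrizable_space_euclidean)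
    moreover have "(\<Union>m. A m) = UNIV"
    proof -
      have "v \<in> (\<Union>m. A m)" for v
      proof -
        have "Bseq (\<lambda>N. basis_proj x N v)"
          using basis_proj_tendsto convergentI Bseq_eq_bounded convergent_imp_Bseq by blast
        then obtain K where "\<And>N. norm (basis_proj x N v) \<le> K"
          by (auto simp: Bseq_def)
        moreover obtain m where "K \<le> real m"
          using real_arch_simple by blast
        ultimately show ?thesis
          by (auto simp: A_def intro: order_trans)
      qed
      then show ?thesis by blast
    qed
    then have "(\<Union>m. closure (A m)) = UNIV"
      using closure_subset by blast
    ultimately show False by simp
  qed
  then obtain m u d where d: "d > 0" "ball u d \<subseteq> closure (A m)"
    by (metis all_not_in_conv mem_interior)
  text \<open>The sets \<open>A m\<close> are convex and symmetric, so the ball can be moved to the origin.\<close>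
  have dense0: "\<exists>a\<in>A m. norm (w - a) < e" if "norm w < d" "e > 0" for w e
  proof -
    have "u + w \<in> closure (A m)" "u - w \<in> closure (A m)"
      using d that by (auto simp: subset_iff dist_norm)
    then obtain a b where ab: "a \<in> A m" "b \<in> A m" "dist a (u + w) < e" "dist b (u - w) < e"
      using \<open>e > 0\<close> by (meson closure_approachable)
    define c where "c = (1/2) *\<^sub>R (a - b)"
    have "c \<in> A m"
    proof -
      have "norm (basis_proj x N c) \<le> m" for N
      proof -
        have "norm (basis_proj x N a) \<le> m" "norm (basis_proj x N b) \<le> m"
          using ab by (auto simp: A_def)
        then show ?thesis
          using norm_triangle_ineq4[of "basis_proj x N a" "basis_proj x N b"]
          by (simp add: c_def P.scale P.diff)
      qed
      then show ?thesis by (simp add: A_def)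
    qed
    moreover have "w - c = (1/2) *\<^sub>R (((u + w) - a) - ((u - w) - b))"
      by (simp add: c_def algebra_simps flip: scaleR_add_left)
    then have "norm (w - c) \<le> (1/2) * (norm ((u + w) - a) + norm ((u - w) - b))"
      using norm_triangle_ineq4[of "(u + w) - a" "(u - w) - b"] by simp
    then have "norm (w - c) < e"
      using ab by (simp add: dist_norm norm_minus_commute)
    ultimately show ?thesis by blast
  qed
  have "\<exists>a. norm (w - a) \<le> norm w / 2 \<and> (\<forall>N. norm (basis_proj x N a) \<le> (2 * m / d) * norm w)" for w
  proof (cases "w = 0")
    case True
    then show ?thesis by (intro exI[of _ 0]) (simp add: P.zero)
  next
    case False
    \<comment> \<open>This scale gives \<open>s *\<^sub>R w\<close> norm \<open>d / 2\<close>,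
      inside the ball. Scaling back by \<open>1 / s\<close> turns the error \<open>d / 4\<close>
      into \<open>norm w / 2\<close> and the bound \<open>m\<close> into
      \<open>2 * m / d * norm w\<close>.\<close>
    define s where "s = d / (2 * norm w)"
    have "s > 0" using d False by (simp add: s_def)
    have "norm (s *\<^sub>R w) < d"
      using d False by (simp add: s_def)
    then obtain a where a: "a \<in> A m" "norm (s *\<^sub>R w - a) < d / 4"
      using dense0[of "s *\<^sub>R w" "d / 4"] d by auto
    have "w - (1/s) *\<^sub>R a = (1/s) *\<^sub>R (s *\<^sub>R w - a)"
      using \<open>s > 0\<close> by (simp add: scaleR_diff_right)
    then have "norm (w - (1/s) *\<^sub>R a) = (1/s) * norm (s *\<^sub>R w - a)"
      using \<open>s > 0\<close> by simp
    also have "\<dots> \<le> (1/s) * (d / 4)"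
      using a \<open>s > 0\<close> by (intro mult_left_mono) auto
    also have "\<dots> = norm w / 2"
      using d False by (simp add: s_def)
    finally have "norm (w - (1/s) *\<^sub>R a) \<le> norm w / 2" .
    moreover have "norm (basis_proj x N ((1/s) *\<^sub>R a)) \<le> (2 * m / d) * norm w" for N
    proof -
      have "norm (basis_proj x N ((1/s) *\<^sub>R a)) = (1/s) * norm (basis_proj x N a)"
        using \<open>s > 0\<close> by (simp add: P.scale)
      also have "\<dots> \<le> (1/s) * m"
        using a \<open>s > 0\<close> by (intro mult_left_mono) (auto simp: A_def)
      finally show ?thesis
        by (simp add: s_def mult_ac)
    qed
    ultimately show ?thesis by blast
  qed
  then show thesis
    using that[of "2 * m / d"] d by simp
qed

text \<open>Iterating the approximation, as in the open mapping theorem, writes \<open>v\<close> as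
  a series of vectors \<open>u j\<close> whose projections decay geometrically, uniformly in
  \<open>N\<close>. Uniqueness of expansions shows that the projections of \<open>v\<close> are the
  sums of these projections.\<close>

lemma basis_proj_bounded: "\<exists>K>0. \<forall>N v. norm (basis_proj x N v) \<le> K * norm v"
proof -
  interpret P: linear "basis_proj x N" for N by (rule linear_basis_proj)
  obtain C where "C \<ge> 0" and
    "\<And>w. \<exists>a. norm (w - a) \<le> norm w / 2 \<and> (\<forall>N. norm (basis_proj x N a) \<le> C * norm w)"
    by (rule basis_proj_dense_bound) blast
  then obtain h where h: "\<And>w. norm (w - h w) \<le> norm w / 2"
      "\<And>w N. norm (basis_proj x N (h w)) \<le> C * norm w"
    by metis
  have "norm (basis_proj x N v) \<le> 2 * C * norm v" for N v
  proof -
    \<comment> \<open>\<open>w j\<close> is the residual after \<open>j\<close> approximations; its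
      norm at least halves each time.\<close>
    define w where "w j = ((\<lambda>w. w - h w) ^^ j) v" for j
    define u where "u j = h (w j)" for j
    have w_le: "norm (w j) \<le> norm v * (1/2) ^ j" for j
    proof (induction j)
      case (Suc j)
      have "norm (w (Suc j)) \<le> norm (w j) / 2"
        using h(1)[of "w j"] by (simp add: w_def)
      with Suc show ?case by simp
    qed (simp add: w_def)
    have sum_u: "(\<Sum>j<n. u j) = v - w n" for n
      by (induction n) (auto simp: w_def u_def)
    have geo: "(\<lambda>j. c * (1/2) ^ j) sums (2 * c)" for c :: real
      using sums_mult[OF geometric_sums[of "1/2 :: real"], of c] by (simp add: mult.commute)
    have "(\<lambda>n. norm (w n)) \<longlonglongrightarrow> 0"
      by (rule Lim_null_comparison[of _ "\<lambda>n. norm v * (1/2) ^ n"])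
         (use w_le summable_LIMSEQ_zero[OF sums_summable[OF geo]] in auto)
    then have u_sums: "u sums v"
      unfolding sums_def sum_u using tendsto_diff[OF tendsto_const tendsto_norm_zero_cancel] by force
    have Pu_le: "norm (basis_proj x N (u j)) \<le> (C * norm v) * (1/2) ^ j" for N j
      using order_trans[OF h(2)[of N "w j"] mult_left_mono[OF w_le[of j] \<open>C \<ge> 0\<close>]]
      by (simp add: u_def mult.assoc)
    \<comment> \<open>The bound on the projections of \<open>u j\<close> is uniform in
      \<open>N\<close>, so it passes to their limit \<open>u j\<close>.\<close>
    have u_le: "norm (u j) \<le> (C * norm v) * (1/2) ^ j" for j
      by (rule tendsto_upperbound[OF tendsto_norm[OF basis_proj_tendsto]]) (auto simp: Pu_le)
    have Pu_summable: "summable (\<lambda>j. basis_proj x N (u j))" for N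
      by (rule summable_comparison_test'[OF sums_summable[OF geo] Pu_le])
    \<comment> \<open>These are the candidate coordinates of \<open>v\<close>: the series of the
      \<open>u j\<close> is summed coordinatewise.\<close>
    define b where "b i = (\<Sum>j. coord x (u j) i)" for i
    have coord_summable: "summable (\<lambda>j. coord x (u j) i)" for i
    proof (rule summable_comparison_test'[OF sums_summable[OF geo]])
      fix j
      have "\<bar>coord x (u j) i\<bar> * norm (x i) \<le> 2 * ((C * norm v) * (1/2) ^ j)"
        using norm_triangle_ineq4[of "basis_proj x (Suc i) (u j)" "basis_proj x i (u j)"]
          Pu_le[of "Suc i" j] Pu_le[of i j]
        by (simp flip: norm_scaleR add: coord_scaleR_eq_diff)
      then show "norm (coord x (u j) i) \<le> (2 * C * norm v / norm (x i)) * (1/2) ^ j"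
        using basis_nonzero[of i] by (simp add: field_simps)
    qed
    have b_sum: "(\<Sum>i<N. b i *\<^sub>R x i) = (\<Sum>j. basis_proj x N (u j))" for N
      unfolding b_def basis_proj_def
      by (subst suminf_sum) (auto intro!: summable_scaleR_left coord_summable sum.cong
            simp: suminf_scaleR_left coord_summable)
    \<comment> \<open>Tannery's theorem interchanges the limit in \<open>N\<close> with the sum over
      \<open>j\<close>. This is what makes \<open>b\<close> an expansion of \<open>v\<close>,
      although no projection is yet known to be continuous.\<close>
    have lim: "(\<lambda>N. \<Sum>j. norm (basis_proj x N (u j) - u j)) \<longlonglongrightarrow> (\<Sum>j. 0)"
    proof (rule conjunct2[OF conjunct2[OF tannerys_theorem]])
      show "((\<lambda>N. norm (basis_proj x N (u j) - u j)) \<longlongrightarrow> 0) sequentially" for j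
        using basis_proj_tendsto LIM_zero tendsto_norm_zero by blast
      show "\<forall>\<^sub>F (j, N) in sequentially \<times>\<^sub>F sequentially.
              norm (norm (basis_proj x N (u j) - u j)) \<le> (2 * C * norm v) * (1/2) ^ j"
      proof (rule always_eventually, clarify)
        fix j N
        show "norm (norm (basis_proj x N (u j) - u j)) \<le> (2 * C * norm v) * (1/2) ^ j"
          using norm_triangle_ineq4[of "basis_proj x N (u j)" "u j"] Pu_le[of N j] u_le[of j] by simp
      qed
    qed (auto intro: sums_summable[OF geo])
    have le: "norm ((\<Sum>i<N. b i *\<^sub>R x i) - v) \<le> (\<Sum>j. norm (basis_proj x N (u j) - u j))" for N
    proof -
      have "summable (\<lambda>j. norm (basis_proj x N (u j) - u j))"
      proof (rule summable_comparison_test'[OF sums_summable[OF geo]])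
        show "norm (norm (basis_proj x N (u j) - u j)) \<le> (2 * C * norm v) * (1/2) ^ j" for j
          using norm_triangle_ineq4[of "basis_proj x N (u j)" "u j"] Pu_le[of N j] u_le[of j] by simp
      qed
      moreover have "(\<Sum>i<N. b i *\<^sub>R x i) - v = (\<Sum>j. basis_proj x N (u j) - u j)"
        using suminf_diff[OF Pu_summable[of N] sums_summable[OF u_sums]]
        by (simp add: b_sum sums_unique[OF u_sums, symmetric])
      ultimately show ?thesis
        by (simp add: summable_norm)
    qed
    have "(\<lambda>N. (\<Sum>i<N. b i *\<^sub>R x i) - v) \<longlonglongrightarrow> 0"
      by (rule Lim_null_comparison[OF always_eventually[OF allI[OF le]]]) (use lim in simp)
    then have "coord x v = b"
      by (intro coord_unique) (simp add: sums_def LIM_zero_iff)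
    then have "basis_proj x N v = (\<Sum>j. basis_proj x N (u j))"
      by (simp add: basis_proj_def[of x N v] b_sum)
    moreover have Pu_norm_summable: "summable (\<lambda>j. norm (basis_proj x N (u j)))"
      by (rule summable_comparison_test'[OF sums_summable[OF geo, of "C * norm v"]]) (use Pu_le in simp)
    have "norm (\<Sum>j. basis_proj x N (u j)) \<le> (\<Sum>j. (C * norm v) * (1/2) ^ j)"
      by (rule order_trans[OF summable_norm[OF Pu_norm_summable]])
         (rule suminf_le[OF Pu_le Pu_norm_summable sums_summable[OF geo]])
    ultimately show ?thesis
      using sums_unique[OF geo[of "C * norm v"]] by (simp add: mult.assoc)
  qed
  \<comment> \<open>Adding 1 makes the constant strictly positive even when
    \<open>C = 0\<close>.\<close>
  then have "norm (basis_proj x N v) \<le> (2 * C + 1) * norm v" for N v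
    by (rule order_trans) (simp add: mult_right_mono)
  then show ?thesis
    using \<open>C \<ge> 0\<close> by (intro exI[of _ "2 * C + 1"]) simp
qed

lemma bounded_linear_basis_proj: "bounded_linear (basis_proj x N)"
proof -
  obtain K where "K > 0" "\<And>N v. norm (basis_proj x N v) \<le> K * norm v"
    using basis_proj_bounded by auto
  then show ?thesis
    by (intro bounded_linear_intro[where K = K])
       (simp_all add: linear_add[OF linear_basis_proj] linear_scale[OF linear_basis_proj] mult.commute)
qed

text \<open>A coordinate term is the difference of two consecutive projections. Coordinates thus
  become functionals to which scalar convergence applies.\<close>

lemma bounded_linear_coord: "bounded_linear (\<lambda>v. coord x v i)"
proof -
  obtain K where "K > 0" and K: "\<And>N v. norm (basis_proj x N v) \<le> K * norm v"
    using basis_proj_bounded by auto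
  have "\<bar>coord x v i\<bar> * norm (x i) \<le> 2 * K * norm v" for v
    using norm_triangle_ineq4[of "basis_proj x (Suc i) v" "basis_proj x i v"] K[of "Suc i" v] K[of i v]
    by (simp flip: norm_scaleR add: coord_scaleR_eq_diff)
  then show ?thesis
    using basis_nonzero[of i]
    by (intro bounded_linear_intro[where K = "2 * K / norm (x i)"])
       (auto simp: coord_add coord_scaleR field_simps)
qed

end

section \<open>Functionals on blockings\<close>

text \<open>This moves conjugacy from \<open>ennreal\<close> to the reals, along the case split of
  \<open>lq_norm\<close>. The conventions \<open>1 / 0 = top\<close> and \<open>1 / top = 0\<close>
  exclude \<open>q' = 0\<close>, and \<open>1 < q\<close> excludes \<open>q' = top\<close>.\<close>

lemma conjugate_exponent_cases:
  fixes q q' :: ennreal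
  assumes "1 < q" "1 / q + 1 / q' = 1"
  obtains (infinite) "q = top" "q' = 1"
  | (finite) s r where "q = ennreal s" "q' = ennreal r" "1 < s" "1 < r" "1 / s + 1 / r = 1"
proof (cases q)
  case (real s)
  then have "s > 1" using assms(1) by (simp add: ennreal_less_iff flip: ennreal_1)
  then have q: "1 / q = ennreal (1 / s)"
    using real by (simp add: divide_ennreal flip: ennreal_1)
  show thesis
  proof (cases q')
    case q': (real r)
    have "r \<noteq> 0"
      using assms(2) q' by auto
    then have "1 / q' = ennreal (1 / r)"
      using q' by (simp add: divide_ennreal flip: ennreal_1)
    then have sum1: "1 / s + 1 / r = 1"
      using assms(2) q \<open>s > 1\<close> q' \<open>r \<noteq> 0\<close>
      by (simp flip: ennreal_plus ennreal_1)
    moreover have "1 / s > 0" using \<open>s > 1\<close> by simp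
    ultimately have "1 / r < 1" by linarith
    then have "r > 1" using q' \<open>r \<noteq> 0\<close> by (simp add: field_simps)
    then show thesis using real q' \<open>s > 1\<close> sum1 finite by blast
  next
    case top
    then have "ennreal (1 / s) = ennreal 1" using assms(2) q by simp
    then show thesis using \<open>s > 1\<close> by (simp add: field_simps del: ennreal_1)
  qed
next
  case top
  then have q': "1 / q' = 1" using assms(2) by simp
  have "q' = 1"
  proof (cases q')
    case (real r)
    have "r \<noteq> 0" using q' real by auto
    then have "ennreal (1 / r) = ennreal 1"
      using q' real by (simp add: divide_ennreal flip: ennreal_1)
    then show ?thesis using real \<open>r \<noteq> 0\<close> by (simp add: field_simps)
  qed (use q' in simp)
  then show thesis using top infinite by blast
qed

text \<open>The extremal vector of Hoelder's inequality is tested: each \<open>y k\<close> nearly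
  attains \<open>a k\<close> and gets weight \<open>a k powr (r - 1)\<close>. The upper estimate
  then bounds the partial sums \<open>S n\<close> by a constant times
  \<open>S n powr (1 / q)\<close>, and this power can be absorbed.\<close>

lemma upper_estimate_dual_summable:
  fixes \<phi> :: "'a::banach \<Rightarrow>\<^sub>L real"
  assumes q: "1 < q" "1 / q + 1 / q' = 1" and B: "upper_estimate q B" "\<And>k. subspace (B k)"
    and a: "\<And>k. 0 \<le> a k" "\<And>k. \<exists>y\<in>B k. norm y \<le> K \<and> a k \<le> 2 * \<phi> y"
    and "K > 0"
  shows "summable (\<lambda>k. a k powr enn2real q')"
proof -
  define r where "r = enn2real q'"
  obtain c where c: "c > 0"
    "\<And>n y. (\<forall>i\<le>n. y i \<in> B i) \<Longrightarrow> norm (\<Sum>i\<le>n. y i) \<le> c * lq_norm q n (\<lambda>i. norm (y i))"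
    using B(1) unfolding upper_estimate_def by blast
  obtain y where y: "\<And>k. y k \<in> B k" "\<And>k. norm (y k) \<le> K" "\<And>k. a k \<le> 2 * \<phi> (y k)"
    using a(2) by metis
  define z where "z k = (a k powr (r - 1)) *\<^sub>R y k" for k
  define S where "S n = (\<Sum>k\<le>n. a k powr r)" for n
  define D where "D = 2 * norm \<phi> * c * K"
  have "D \<ge> 0" using \<open>K > 0\<close> c by (simp add: D_def)
  have S_nonneg: "0 \<le> S n" for n by (simp add: S_def sum_nonneg)
  have z_le: "norm (z k) \<le> K * a k powr (r - 1)" for k
    using y(2)[of k] by (simp add: z_def mult.commute[of K] mult_left_mono mult.commute[of "norm (y k)"])
  have powr_split: "a k powr r = a k powr (r - 1) * a k" for k
    using a(1)[of k] powr_add[of "a k" "r - 1" 1] by (cases "a k = 0") auto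
  have S_le: "S n \<le> 2 * norm \<phi> * c * lq_norm q n (\<lambda>i. norm (z i))" for n
  proof -
    have "S n \<le> (\<Sum>k\<le>n. 2 * \<phi> (z k))"
      unfolding S_def
    proof (rule sum_mono)
      show "a k powr r \<le> 2 * \<phi> (z k)" for k
        using mult_left_mono[OF y(3)[of k], of "a k powr (r - 1)"]
        by (simp add: powr_split z_def blinfun.scaleR_right mult_ac)
    qed
    also have "\<dots> = 2 * \<phi> (\<Sum>k\<le>n. z k)"
      by (simp add: blinfun.sum_right sum_distrib_left)
    also have "\<dots> \<le> 2 * (norm \<phi> * norm (\<Sum>k\<le>n. z k))"
      using norm_blinfun[of \<phi> "\<Sum>k\<le>n. z k"] by simp
    also have "\<dots> \<le> 2 * (norm \<phi> * (c * lq_norm q n (\<lambda>i. norm (z i))))"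
      using y(1) B(2) by (intro mult_left_mono c) (auto simp: z_def intro: subspace_scale)
    finally show ?thesis by (simp add: mult.assoc)
  qed
  have "S n \<le> D powr r" for n
    using q
  proof (cases rule: conjugate_exponent_cases)
    case infinite
    then have r: "r = 1" by (simp add: r_def)
    have "lq_norm q n (\<lambda>i. norm (z i)) \<le> K"
      unfolding lq_norm_def using infinite z_le \<open>K > 0\<close>
      \<comment> \<open>For \<open>r = 1\<close> the weights are \<open>a k powr 0\<close>, which is
        1, or 0 when \<open>a k = 0\<close>.\<close>
      by (auto simp: r intro: order_trans[OF z_le])
    then have "S n \<le> (2 * norm \<phi> * c) * K"
      using c by (intro order_trans[OF S_le] mult_left_mono) auto
    then show ?thesis using \<open>D \<ge> 0\<close> by (simp add: r D_def)
  next
    case (finite s r')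
    have [simp]: "enn2real q = s" using finite by simp
    have r: "r > 1" "1 / s + 1 / r = 1" using finite by (auto simp: r_def)
    \<comment> \<open>By this identity the \<open>s\<close>-th powers of the weights are again the
      terms of \<open>S n\<close>.\<close>
    then have rs: "(r - 1) * s = r" using \<open>s > 1\<close> by (simp add: field_simps)
    have "(\<Sum>i\<le>n. \<bar>norm (z i)\<bar> powr s) \<le> (\<Sum>i\<le>n. K powr s * a i powr r)"
    proof (rule sum_mono)
      fix i
      have "\<bar>norm (z i)\<bar> powr s \<le> (K * a i powr (r - 1)) powr s"
        using z_le[of i] \<open>s > 1\<close> by (intro powr_mono2) auto
      also have "\<dots> = K powr s * a i powr r"
        using \<open>K > 0\<close> by (simp add: powr_mult powr_powr rs)
      finally show "\<bar>norm (z i)\<bar> powr s \<le> K powr s * a i powr r" .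
    qed
    then have "lq_norm q n (\<lambda>i. norm (z i)) \<le> (K powr s * S n) powr (1 / s)"
      using finite unfolding lq_norm_def
      by (auto simp: S_def sum_distrib_left intro!: powr_mono2 sum_nonneg)
    also have "\<dots> = K * S n powr (1 / s)"
      using \<open>K > 0\<close> S_nonneg[of n] \<open>s > 1\<close> by (simp add: powr_mult powr_powr)
    finally have "S n \<le> (2 * norm \<phi> * c) * (K * S n powr (1 / s))"
      using c by (intro order_trans[OF S_le] mult_left_mono) auto
    then have S_le': "S n \<le> D * S n powr (1 / s)" by (simp add: D_def mult.assoc)
    show ?thesis
    proof (cases "S n = 0")
      case False
      then have "S n > 0" using S_nonneg[of n] by simp
      \<comment> \<open>Conjugacy splits \<open>S n\<close> so that the positive factor
        \<open>S n powr (1 / s)\<close> cancels.\<close>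
      then have "S n powr (1 / s) * S n powr (1 / r) = S n"
        using r by (simp flip: powr_add)
      then have "S n powr (1 / s) * S n powr (1 / r) \<le> S n powr (1 / s) * D"
        using S_le' by (simp add: mult.commute)
      then have "S n powr (1 / r) \<le> D" using \<open>S n > 0\<close> by simp
      then have "(S n powr (1 / r)) powr r \<le> D powr r"
        using r by (intro powr_mono2) auto
      then show ?thesis using r \<open>S n > 0\<close> by (simp add: powr_powr)
    qed simp
  qed
  then have "summable (\<lambda>k. a k powr r)"
    unfolding S_def by (intro bounded_imp_summable) auto
  then show ?thesis by (simp add: r_def)
qed

text \<open>Here \<open>a k\<close> is the norm of \<open>\<phi>\<close> composed with the
  \<open>k\<close>-th block projection. Block projections have norm at most \<open>2 * K\<close>, so
  the image of a nearly norming vector is a bounded element of the block on which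
  \<open>\<phi>\<close> is at least \<open>a k / 2\<close>.\<close>

lemma blocking_functional_bound:
  fixes x :: "nat \<Rightarrow> 'a::banach" and \<phi> :: "'a \<Rightarrow>\<^sub>L real"
  assumes "schauder_basis x" and est: "\<And>B. blocking x B \<Longrightarrow> upper_estimate q B"
    and q: "1 < q" "1 / q + 1 / q' = 1" and m: "strict_mono m" "m 0 = 0"
  obtains a where "\<And>k. 0 \<le> a k" "summable (\<lambda>k. a k powr enn2real q')"
    "\<And>k v. \<bar>\<phi> (basis_proj x (m (Suc k)) v - basis_proj x (m k) v)\<bar> \<le> a k * norm v"
proof -
  note bl = bounded_linear_basis_proj[OF assms(1)]
  define Q where "Q k v = basis_proj x (m (Suc k)) v - basis_proj x (m k) v" for k v
  have bl_Q: "bounded_linear (Q k)" for k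
    unfolding Q_def by (intro bounded_linear_sub bl)
  have bl_\<phi>Q: "bounded_linear (\<lambda>v. \<phi> (Q k v))" for k
    by (intro bounded_linear_compose[OF _ bl_Q] blinfun.bounded_linear_right)
  define a where "a k = onorm (\<lambda>v. \<phi> (Q k v))" for k
  define B where "B k = span (x ` {m k..<m (Suc k)})" for k
  have "blocking x B"
    using m unfolding blocking_def B_def by blast
  have Q_in: "Q k v \<in> B k" for k v
  proof -
    have "m k \<le> m (Suc k)" using m(1) by (simp add: strict_mono_less_eq)
    then have "Q k v = (\<Sum>i\<in>{m k..<m (Suc k)}. coord x v i *\<^sub>R x i)"
      unfolding Q_def basis_proj_def lessThan_atLeast0 by (subst sum_diff_nat_ivl) auto
    then show ?thesis
      unfolding B_def by (simp only:) (rule span_sum, rule span_scale, rule span_base, rule imageI)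
  qed
  obtain K where K: "K > 0" "\<And>N v. norm (basis_proj x N v) \<le> K * norm v"
    using basis_proj_bounded[OF assms(1)] by auto
  have Q_le: "norm (Q k v) \<le> 2 * K * norm v" for k v
    using norm_triangle_ineq4[of "basis_proj x (m (Suc k)) v" "basis_proj x (m k) v"]
      K(2)[of "m (Suc k)" v] K(2)[of "m k" v] by (simp add: Q_def)
  have a_nonneg: "0 \<le> a k" for k
    unfolding a_def by (rule onorm_pos_le[OF bl_\<phi>Q])
  have "\<exists>y\<in>B k. norm y \<le> 2 * K \<and> a k \<le> 2 * \<phi> y" for k
  proof (cases "a k = 0")
    case True
    then show ?thesis using K by (intro bexI[of _ 0]) (auto simp: B_def span_zero)
  next
    case False
    have "\<exists>v. \<bar>\<phi> (Q k v)\<bar> > a k / 2 * norm v"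
    proof (rule ccontr)
      assume "\<not> ?thesis"
      then have "norm (\<phi> (Q k v)) \<le> a k / 2 * norm v" for v
        by (simp add: not_less)
      then have "onorm (\<lambda>v. \<phi> (Q k v)) \<le> a k / 2"
        using a_nonneg[of k] by (intro onorm_bound) auto
      then show False using False a_nonneg[of k] by (simp flip: a_def)
    qed
    then obtain v where v: "\<bar>\<phi> (Q k v)\<bar> > a k / 2 * norm v" by blast
    then have "v \<noteq> 0" by (auto simp: linear_0[OF bounded_linear.linear[OF bl_Q]])
    \<comment> \<open>The factor normalizes \<open>v\<close> and makes the value of
      \<open>\<phi>\<close> nonnegative.\<close>
    define t where "t = sgn (\<phi> (Q k v)) / norm v"
    have "norm (t *\<^sub>R v) \<le> 1"
      using \<open>v \<noteq> 0\<close> by (simp add: t_def abs_sgn_eq)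
    then have Q_norm: "norm (Q k (t *\<^sub>R v)) \<le> 2 * K"
      using K(1) by (intro order_trans[OF Q_le]) (simp add: mult_le_cancel_left1)
    have "\<phi> (Q k (t *\<^sub>R v)) = \<bar>\<phi> (Q k v)\<bar> / norm v"
      by (simp add: linear_scale[OF bounded_linear.linear[OF bl_Q]] blinfun.scaleR_right t_def abs_sgn)
    moreover have "a k / 2 < \<bar>\<phi> (Q k v)\<bar> / norm v"
      using v \<open>v \<noteq> 0\<close> by (simp add: pos_less_divide_eq)
    ultimately have "a k \<le> 2 * \<phi> (Q k (t *\<^sub>R v))"
      by linarith
    with Q_norm Q_in show ?thesis by blast
  qed
  then have "summable (\<lambda>k. a k powr enn2real q')"
    using K(1) est[OF \<open>blocking x B\<close>] a_nonneg
    by (intro upper_estimate_dual_summable[OF q, of B a "2 * K" \<phi>]) (auto simp: B_def)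
  moreover have "\<bar>\<phi> (Q k v)\<bar> \<le> a k * norm v" for k v
    using onorm[OF bl_\<phi>Q, of k v] by (simp add: a_def)
  ultimately show thesis
    using that[of a] a_nonneg by (auto simp: Q_def)
qed

section \<open>Convergence in finite measure spaces\<close>

context complete_measure
begin

lemma borel_measurable_AE_eq:
  fixes f g :: "'a \<Rightarrow> real"
  assumes "f \<in> borel_measurable M" "AE t in M. f t = g t"
  shows "g \<in> borel_measurable M"
proof (rule measurableI)
  fix A :: "real set" assume "A \<in> sets borel"
  then show "g -` A \<inter> space M \<in> sets M"
    using assms(2) by (intro in_sets_AE[OF _ measurable_sets[OF assms(1)]]) auto
qed simp

text \<open>A continuous function preserves the approximation by simple functions, and completeness
  absorbs the exceptional null set. Norms, functionals and projections of the given functions are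
  all handled this way.\<close>

lemma strongly_measurable_continuous:
  fixes \<phi> :: "'b::banach \<Rightarrow> real"
  assumes "strongly_measurable M f" "continuous_on UNIV \<phi>"
  shows "(\<lambda>t. \<phi> (f t)) \<in> borel_measurable M"
proof -
  obtain s where s: "\<And>n. simple_function M (s n)" "AE t in M. (\<lambda>n. s n t) \<longlonglongrightarrow> f t"
    using assms(1) unfolding strongly_measurable_def by blast
  have "(\<lambda>t. \<phi> (s n t)) \<in> borel_measurable M" for n
    by (intro borel_measurable_simple_function simple_function_compose1[OF s(1)])
  \<comment> \<open>\<open>lim\<close> has a value also where the sequence diverges, which gives a
    measurable function on the whole space.\<close>
  then have "(\<lambda>t. lim (\<lambda>n. \<phi> (s n t))) \<in> borel_measurable M"
    by (rule borel_measurable_lim_metric)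
  moreover have "AE t in M. lim (\<lambda>n. \<phi> (s n t)) = \<phi> (f t)"
    using s(2)
  proof eventually_elim
    case (elim t)
    then have "(\<lambda>n. \<phi> (s n t)) \<longlonglongrightarrow> \<phi> (f t)"
      using continuous_on_tendsto_compose[OF assms(2)] by simp
    then show ?case by (rule limI)
  qed
  ultimately show ?thesis by (rule borel_measurable_AE_eq)
qed

end

lemma strongly_measurable_diff:
  assumes "strongly_measurable M f" "strongly_measurable M g"
  shows "strongly_measurable M (\<lambda>t. f t - g t)"
proof -
  obtain s where s: "\<And>n. simple_function M (s n)" "AE t in M. (\<lambda>n. s n t) \<longlonglongrightarrow> f t"
    using assms(1) unfolding strongly_measurable_def by blast
  obtain s' where s': "\<And>n. simple_function M (s' n)" "AE t in M. (\<lambda>n. s' n t) \<longlonglongrightarrow> g t"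
    using assms(2) unfolding strongly_measurable_def by blast
  have "AE t in M. (\<lambda>n. s n t - s' n t) \<longlonglongrightarrow> f t - g t"
    using s(2) s'(2) by eventually_elim (rule tendsto_diff)
  moreover have "simple_function M (\<lambda>t. s n t - s' n t)" for n
    by (rule simple_function_compose2[OF s(1) s'(1)])
  ultimately show ?thesis
    unfolding strongly_measurable_def by (intro exI[of _ "\<lambda>n t. s n t - s' n t"]) simp
qed

text \<open>Dominated convergence applies to the indicators; the constant 1 is integrable because
  the measure is finite.\<close>

lemma (in finite_measure) tendsto_AE_imp_measure_tendsto_0:
  fixes u :: "nat \<Rightarrow> 'a \<Rightarrow> real"
  assumes [measurable]: "\<And>n. u n \<in> borel_measurable M"
    and u: "AE t in M. (\<lambda>n. u n t) \<longlonglongrightarrow> 0" and "\<epsilon> > 0"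
  shows "(\<lambda>n. measure M {t \<in> space M. u n t > \<epsilon>}) \<longlonglongrightarrow> 0"
proof -
  have "(\<lambda>n. \<integral>t. indicat_real {t \<in> space M. u n t > \<epsilon>} t \<partial>M) \<longlonglongrightarrow> (\<integral>t. 0 \<partial>M)"
  proof (rule integral_dominated_convergence[where w = "\<lambda>_. 1"])
    show "AE t in M. (\<lambda>n. indicat_real {t \<in> space M. u n t > \<epsilon>} t) \<longlonglongrightarrow> 0"
      using u
    proof eventually_elim
      case (elim t)
      then have "\<forall>\<^sub>F n in sequentially. u n t < \<epsilon>"
        using \<open>\<epsilon> > 0\<close> by (rule order_tendstoD)
      then have "\<forall>\<^sub>F n in sequentially. indicat_real {t \<in> space M. u n t > \<epsilon>} t = 0"
        by eventually_elim auto
      then show ?case by (rule tendsto_eventually)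
    qed
  qed (auto simp: indicator_def)
  then show ?thesis by (simp add: Int_def conj_commute)
qed

lemma (in finite_measure) AE_tendsto_0_of_fast_in_measure:
  fixes u :: "nat \<Rightarrow> 'a \<Rightarrow> real"
  assumes [measurable]: "\<And>k. u k \<in> borel_measurable M"
    and u: "\<And>k. measure M {t \<in> space M. u k t > (1/2) ^ k} \<le> (1/2) ^ k" "\<And>k t. 0 \<le> u k t"
  shows "AE t in M. (\<lambda>k. u k t) \<longlonglongrightarrow> 0"
proof -
  have "summable (\<lambda>k. measure M {t \<in> space M. u k t > (1/2) ^ k})"
    by (rule summable_comparison_test'[of "\<lambda>k. (1/2) ^ k"]) (use u in auto)
  then have "AE t in M. \<forall>\<^sub>F k in sequentially. t \<in> space M - {t \<in> space M. u k t > (1/2) ^ k}"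
    by (intro borel_cantelli_AE1) (auto simp: less_top[symmetric])
  then show ?thesis
  proof eventually_elim
    case (elim t)
    then have "\<forall>\<^sub>F k in sequentially. norm (u k t) \<le> (1/2) ^ k"
      by eventually_elim (use u in auto)
    then show ?case
      by (rule Lim_null_comparison) (simp add: LIMSEQ_realpow_zero)
  qed
qed

text \<open>The sum of all \<open>r\<close>-th powers has integral at most \<open>C\<close> times
  the sum of \<open>a k powr r\<close>. It is therefore finite almost everywhere, and its terms tend
  to 0.\<close>

lemma AE_tendsto_0_of_summable_powr:
  fixes u :: "nat \<Rightarrow> 'a \<Rightarrow> real"
  assumes [measurable]: "\<And>k. u k \<in> borel_measurable M"
    and "r > 0" and a: "summable (\<lambda>k. a k powr r)" "\<And>k. 0 \<le> a k" and "C \<ge> 0"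
    and u: "\<And>k. (\<integral>\<^sup>+t. ennreal (\<bar>u k t\<bar> powr r) \<partial>M) \<le> ennreal C"
  shows "AE t in M. (\<lambda>k. a k * u k t) \<longlonglongrightarrow> 0"
proof -
  have int: "(\<integral>\<^sup>+t. ennreal (\<bar>a k * u k t\<bar> powr r) \<partial>M) \<le> ennreal (C * a k powr r)" for k
  proof -
    have "(\<integral>\<^sup>+t. ennreal (\<bar>a k * u k t\<bar> powr r) \<partial>M) = (\<integral>\<^sup>+t. ennreal (a k powr r) * ennreal (\<bar>u k t\<bar> powr r) \<partial>M)"
      using a by (simp add: abs_mult powr_mult ennreal_mult)
    also have "\<dots> = ennreal (a k powr r) * (\<integral>\<^sup>+t. ennreal (\<bar>u k t\<bar> powr r) \<partial>M)"
      by (rule nn_integral_cmult) measurable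
    also have "\<dots> \<le> ennreal (a k powr r) * ennreal C"
      by (intro mult_left_mono u) auto
    finally show ?thesis using \<open>C \<ge> 0\<close> by (simp add: ennreal_mult mult.commute)
  qed
  have "(\<integral>\<^sup>+t. (\<Sum>k. ennreal (\<bar>a k * u k t\<bar> powr r)) \<partial>M)
      = (\<Sum>k. \<integral>\<^sup>+t. ennreal (\<bar>a k * u k t\<bar> powr r) \<partial>M)"
    by (rule nn_integral_suminf) measurable
  also have "\<dots> \<le> (\<Sum>k. ennreal (C * a k powr r))"
    by (intro suminf_le int) auto
  also have "\<dots> < \<infinity>"
    using summable_mult[OF a(1), of C] \<open>C \<ge> 0\<close> by (simp add: suminf_ennreal2)
  finally have "AE t in M. (\<Sum>k. ennreal (\<bar>a k * u k t\<bar> powr r)) \<noteq> \<infinity>"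
    by (intro nn_integral_noteq_infinite) auto
  then show ?thesis
  proof eventually_elim
    case (elim t)
    then have "summable (\<lambda>k. \<bar>a k * u k t\<bar> powr r)"
      by (intro summable_suminf_not_top) auto
    then have "(\<lambda>k. \<bar>a k * u k t\<bar> powr r) \<longlonglongrightarrow> 0"
      by (rule summable_LIMSEQ_zero)
    then have "(\<lambda>k. (\<bar>a k * u k t\<bar> powr r) powr (1 / r)) \<longlonglongrightarrow> 0 powr (1 / r)"
      using \<open>r > 0\<close> by (intro tendsto_powr2 tendsto_const) auto
    then show ?case
      using \<open>r > 0\<close> by (simp add: powr_powr tendsto_rabs_zero_iff)
  qed
qed

section \<open>Lebesgue measure on the unit interval and moments of bounded sequences\<close>

lemma complete_measure_unit_interval: "complete_measure unit_interval"
proof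
  fix A B :: "real set" assume "A \<subseteq> B" "B \<in> null_sets unit_interval"
  then show "A \<in> sets unit_interval"
    by (auto simp: null_sets_restrict_space sets_restrict_space_iff intro: completion.complete)
qed

lemma finite_measure_unit_interval: "finite_measure unit_interval"
  by (intro finite_measure_lebesgue_on) simp

lemma emeasure_unit_interval: "emeasure unit_interval {0..1} = 1"
  by (simp add: emeasure_restrict_space)

text \<open>On a probability space a bound with exponent \<open>p\<close> controls every smaller
  exponent. For finite \<open>p\<close> this follows from the pointwise inequality
  \<open>c powr r \<le> 1 + c powr s\<close>, for \<open>p = top\<close> from the essential
  supremum.\<close>

lemma Lp_bounded_moment:
  fixes f :: "nat \<Rightarrow> real \<Rightarrow> 'a::banach"
  assumes "Lp_bounded unit_interval p f" "ennreal r \<le> p" "1 \<le> r"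
  shows "\<exists>C\<ge>0. \<forall>n. (\<integral>\<^sup>+t. ennreal (norm (f n t) powr r) \<partial>unit_interval) \<le> ennreal C"
proof -
  interpret complete_measure unit_interval by (rule complete_measure_unit_interval)
  let ?M = unit_interval
  have in_Lp: "in_Lp ?M p (f n)" for n
    using assms by (simp add: Lp_bounded_def)
  then have [measurable]: "(\<lambda>t. norm (f n t)) \<in> borel_measurable ?M" for n
    by (intro strongly_measurable_continuous continuous_intros) (auto simp: in_Lp_def)
  obtain C0 where C0: "\<And>n. Lp_norm ?M p (f n) \<le> C0"
    using assms(1) by (auto simp: Lp_bounded_def bdd_above_def)
  define C where "C = max C0 0"
  have C: "Lp_norm ?M p (f n) \<le> C" "C \<ge> 0" for n
    using C0[of n] by (auto simp: C_def)
  show ?thesis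
  proof (cases "p = top")
    case True
    have "(\<integral>\<^sup>+t. ennreal (norm (f n t) powr r) \<partial>?M) \<le> ennreal (C powr r)" for n
    proof -
      let ?e = "esssup ?M (\<lambda>t. ereal (norm (f n t)))"
      obtain D where D: "AE t in ?M. norm (f n t) \<le> D"
        using in_Lp[of n] True by (auto simp: in_Lp_def)
      have "?e \<le> ereal D"
        by (rule esssup_I) (use D in auto)
      moreover have "?e \<ge> 0"
        using esssup_AE_mono[of "\<lambda>_. 0" ?M "\<lambda>t. ereal (norm (f n t))"] esssup_const[of ?M "0::ereal"]
        by (simp add: emeasure_unit_interval)
      \<comment> \<open>\<open>real_of_ereal\<close> sends both infinities to 0, so finiteness is
        required before \<open>Lp_norm\<close> says anything about the essential supremum.\<close>
      ultimately have "?e = ereal (real_of_ereal ?e)"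
        by (cases ?e) auto
      then have "?e \<le> ereal C"
        using C(1)[of n] True by (simp add: Lp_norm_def) (metis ereal_less_eq(3))
      then have "AE t in ?M. ereal (norm (f n t)) \<le> ereal C"
        by (intro eventually_mono[OF esssup_AE]) (rule order_trans)
      then have "(\<integral>\<^sup>+t. ennreal (norm (f n t) powr r) \<partial>?M) \<le> (\<integral>\<^sup>+t. ennreal (C powr r) \<partial>?M)"
        using assms by (intro nn_integral_mono_AE) (auto elim!: eventually_mono intro!: ennreal_leI powr_mono2)
      then show ?thesis by (simp add: emeasure_unit_interval)
    qed
    then show ?thesis by (intro exI[of _ "C powr r"]) simp
  next
    case False
    define s where "s = enn2real p"
    have p: "p = ennreal s" using False by (simp add: s_def less_top)
    then have "ennreal r \<le> ennreal s" using assms(2) by simp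
    then have "r \<le> s" by (simp add: ennreal_le_iff s_def)
    have "(\<integral>\<^sup>+t. ennreal (norm (f n t) powr r) \<partial>?M) \<le> ennreal (1 + C powr s)" for n
    proof -
      let ?I = "\<integral>t. norm (f n t) powr s \<partial>?M"
      have int: "integrable ?M (\<lambda>t. norm (f n t) powr s)"
        using in_Lp[of n] False by (simp add: in_Lp_def s_def)
      have "?I \<ge> 0" by simp
      have "?I powr (1 / s) \<le> C"
        using C(1)[of n] False by (simp add: Lp_norm_def s_def)
      then have "(?I powr (1 / s)) powr s \<le> C powr s"
        using assms \<open>r \<le> s\<close> by (intro powr_mono2) auto
      then have I: "?I \<le> C powr s"
        using assms \<open>r \<le> s\<close> \<open>?I \<ge> 0\<close> by (simp add: powr_powr)
      have "norm (f n t) powr r \<le> 1 + norm (f n t) powr s" for t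
      proof (cases "norm (f n t) \<le> 1")
        case True
        then have "norm (f n t) powr r \<le> 1 powr r"
          using assms by (intro powr_mono2) auto
        then show ?thesis by (simp add: add_increasing2)
      next
        case False
        then have "norm (f n t) powr r \<le> norm (f n t) powr s"
          using \<open>r \<le> s\<close> by (intro powr_mono) auto
        then show ?thesis by simp
      qed
      then have "(\<integral>\<^sup>+t. ennreal (norm (f n t) powr r) \<partial>?M) \<le> (\<integral>\<^sup>+t. 1 + ennreal (norm (f n t) powr s) \<partial>?M)"
        by (intro nn_integral_mono) (simp flip: ennreal_1 ennreal_plus)
      also have "\<dots> = 1 + ennreal ?I"
        using int by (simp add: nn_integral_add emeasure_unit_interval nn_integral_eq_integral)
      also have "\<dots> \<le> ennreal (1 + C powr s)"
        using I by (simp flip: ennreal_1 ennreal_plus)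
      finally show ?thesis .
    qed
    then show ?thesis by (intro exI[of _ "1 + C powr s"]) (simp add: add_nonneg_nonneg)
  qed
qed

section \<open>Extraction of the subsequence\<close>

context
  fixes M :: "'t measure" and x :: "nat \<Rightarrow> 'a::banach" and f :: "nat \<Rightarrow> 't \<Rightarrow> 'a" and g
  assumes complete: "complete_measure M" and finite: "finite_measure M"
    and basis: "schauder_basis x"
    and f_meas: "\<And>n. strongly_measurable M (f n)" and g_meas: "strongly_measurable M g"
    and f_tendsto: "scalarly_in_measure M f g"
begin

interpretation complete_measure M by (rule complete)
interpretation finite_measure M by (rule finite)

lemma continuous_on_basis_proj [continuous_intros]:
  "continuous_on S h \<Longrightarrow> continuous_on S (\<lambda>v. basis_proj x N (h v))"
  by (rule bounded_linear.continuous_on[OF bounded_linear_basis_proj[OF basis]])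

lemma borel_measurable_basis_proj_diff:
  "(\<lambda>t. norm (basis_proj x N (f n t - g t))) \<in> borel_measurable M"
  by (rule strongly_measurable_continuous[OF strongly_measurable_diff[OF f_meas g_meas]])
     (intro continuous_intros)

lemma borel_measurable_remainder:
  "(\<lambda>t. norm (f n t - basis_proj x N (f n t))) \<in> borel_measurable M"
  by (rule strongly_measurable_continuous[OF f_meas]) (intro continuous_intros)

text \<open>For fixed \<open>N\<close> only finitely many coordinate functionals occur. Scalar
  convergence handles each of them, and a union bound combines them.\<close>

lemma basis_proj_tendsto_in_measure:
  assumes "\<epsilon> > 0"
  shows "(\<lambda>n. measure M {t \<in> space M. norm (basis_proj x N (f n t - g t)) > \<epsilon>}) \<longlonglongrightarrow> 0"
proof -
  define \<phi> where "\<phi> i = Blinfun (\<lambda>v. coord x v i)" for i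
  have \<phi>: "blinfun_apply (\<phi> i) = (\<lambda>v. coord x v i)" for i
    unfolding \<phi>_def by (rule bounded_linear_Blinfun_apply[OF bounded_linear_coord[OF basis]])
  \<comment> \<open>The summand 1 keeps \<open>L\<close> positive when \<open>N = 0\<close>.
    Coordinate errors of at most \<open>\<epsilon> / L\<close> add up to a vector of norm at most
    \<open>\<epsilon>\<close>.\<close>
  define L where "L = 1 + (\<Sum>i<N. norm (x i))"
  define \<delta> where "\<delta> = \<epsilon> / L"
  have "L > 0" by (simp add: L_def add_pos_nonneg sum_nonneg)
  then have "\<delta> > 0" using assms by (simp add: \<delta>_def)
  define A where "A n i = {t \<in> space M. \<bar>\<phi> i (f n t) - \<phi> i (g t)\<bar> > \<delta>}" for n i
  have A_meas: "A n i \<in> sets M" for n i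
  proof -
    have [measurable]: "(\<lambda>t. \<phi> i (f n t)) \<in> borel_measurable M" "(\<lambda>t. \<phi> i (g t)) \<in> borel_measurable M"
      by (intro strongly_measurable_continuous f_meas g_meas continuous_intros)+
    show ?thesis unfolding A_def by measurable
  qed
  have "(\<lambda>n. measure M (A n i)) \<longlonglongrightarrow> 0" for i
    using f_tendsto \<open>\<delta> > 0\<close> unfolding scalarly_in_measure_def tendsto_in_measure_def A_def by blast
  then have sum_0: "(\<lambda>n. \<Sum>i<N. measure M (A n i)) \<longlonglongrightarrow> 0"
    using tendsto_sum[of "{..<N}" "\<lambda>i n. measure M (A n i)" "\<lambda>_. 0"] by simp
  have le: "measure M {t \<in> space M. norm (basis_proj x N (f n t - g t)) > \<epsilon>} \<le> (\<Sum>i<N. measure M (A n i))" for n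
  proof -
    have "norm (basis_proj x N (f n t - g t)) \<le> \<epsilon>" if "t \<in> space M" "t \<notin> (\<Union>i<N. A n i)" for t
    proof -
      have "norm (coord x (f n t - g t) i *\<^sub>R x i) \<le> \<delta> * norm (x i)" if "i < N" for i
      proof -
        have "\<bar>\<phi> i (f n t - g t)\<bar> \<le> \<delta>"
          using that \<open>t \<notin> _\<close> \<open>t \<in> space M\<close>
          by (auto simp: A_def not_less blinfun.diff_right)
        then show ?thesis by (simp add: \<phi> mult_right_mono)
      qed
      then have "norm (basis_proj x N (f n t - g t)) \<le> (\<Sum>i<N. \<delta> * norm (x i))"
        unfolding basis_proj_def by (intro sum_norm_le) simp
      also have "\<dots> \<le> \<delta> * L"
        using \<open>\<delta> > 0\<close> by (simp add: L_def flip: sum_distrib_left)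
      finally show ?thesis using \<open>L > 0\<close> by (simp add: \<delta>_def)
    qed
    then have "{t \<in> space M. norm (basis_proj x N (f n t - g t)) > \<epsilon>} \<subseteq> (\<Union>i<N. A n i)"
      by force
    then have "measure M {t \<in> space M. norm (basis_proj x N (f n t - g t)) > \<epsilon>} \<le> measure M (\<Union>i<N. A n i)"
      using A_meas by (intro finite_measure_mono) auto
    also have "\<dots> \<le> (\<Sum>i<N. measure M (A n i))"
      using A_meas by (intro finite_measure_subadditive_finite) auto
    finally show ?thesis .
  qed
  show ?thesis
    by (rule Lim_null_comparison[OF always_eventually sum_0]) (use le in simp)
qed

lemma remainder_tendsto_in_measure:
  assumes "\<epsilon> > 0"
  shows "(\<lambda>N. measure M {t \<in> space M. norm (f n t - basis_proj x N (f n t)) > \<epsilon>}) \<longlonglongrightarrow> 0"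
proof (rule tendsto_AE_imp_measure_tendsto_0[OF borel_measurable_remainder _ assms])
  have "(\<lambda>N. norm (f n t - basis_proj x N (f n t))) \<longlonglongrightarrow> 0" for t
    using tendsto_norm[OF tendsto_diff[OF tendsto_const basis_proj_tendsto[OF basis]], of "f n t" "f n t"]
    by simp
  then show "AE t in M. (\<lambda>N. norm (f n t - basis_proj x N (f n t))) \<longlonglongrightarrow> 0"
    by simp
qed

text \<open>With the basis index fixed, late functions have a small head difference; with the
  function fixed, late basis indices leave a small remainder. The two choices alternate, with errors
  small enough for Borel--Cantelli.\<close>

lemma gliding_hump:
  obtains m r :: "nat \<Rightarrow> nat" where "strict_mono m" "m 0 = 0" "strict_mono r"
    "AE t in M. (\<lambda>k. norm (basis_proj x (m k) (f (r k) t - g t))) \<longlonglongrightarrow> 0"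
    "AE t in M. (\<lambda>k. norm (f (r k) t - basis_proj x (m (Suc k)) (f (r k) t))) \<longlonglongrightarrow> 0"
proof -
  define head where "head k N n \<longleftrightarrow>
    measure M {t \<in> space M. norm (basis_proj x N (f n t - g t)) > (1/2) ^ k} \<le> (1/2) ^ k" for k N n
  define tail where "tail k n N \<longleftrightarrow>
    measure M {t \<in> space M. norm (f n t - basis_proj x N (f n t)) > (1/2) ^ k} \<le> (1/2) ^ k" for k n N
  have ev_head: "\<forall>\<^sub>F n in sequentially. head k N n" for k N
    unfolding head_def
    by (rule eventually_mono[OF order_tendstoD(2)[OF basis_proj_tendsto_in_measure[of "(1/2) ^ k" N], of "(1/2) ^ k"]]) simp_all
  have ev_tail: "\<forall>\<^sub>F N in sequentially. tail k n N" for k n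
    unfolding tail_def
    by (rule eventually_mono[OF order_tendstoD(2)[OF remainder_tendsto_in_measure[of "(1/2) ^ k" n], of "(1/2) ^ k"]]) simp_all
  \<comment> \<open>The state \<open>s k\<close> is the pair of \<open>m k\<close> and
    \<open>r k\<close>. The head condition concerns one state, while the tail condition links
    \<open>r k\<close> to \<open>m (k + 1)\<close> and so belongs to the transition. The clause for
    \<open>k = 0\<close> fixes the start at 0, as a blocking requires.\<close>
  have "\<exists>s. \<forall>k. ((k = 0 \<longrightarrow> fst (s k) = 0) \<and> head k (fst (s k)) (snd (s k))) \<and>
      (fst (s k) < fst (s (Suc k)) \<and> snd (s k) < snd (s (Suc k)) \<and> tail k (snd (s k)) (fst (s (Suc k))))"
  proof (rule dependent_nat_choice)
    obtain n where "head 0 0 n"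
      using eventually_happens'[OF _ ev_head[of 0 0]] by auto
    then show "\<exists>s. (0 = (0::nat) \<longrightarrow> fst s = 0) \<and> head 0 (fst s) (snd s)"
      by (intro exI[of _ "(0, n)"]) simp
  next
    fix s :: "nat \<times> nat" and k
    \<comment> \<open>The order matters: the basis index is chosen for the old function, then the
      new function for that index.\<close>
    obtain N where "tail k (snd s) N" "fst s < N"
      using eventually_happens'[OF _ eventually_conj[OF ev_tail[of k "snd s"] eventually_gt_at_top[of "fst s"]]] by auto
    moreover obtain n where "head (Suc k) N n" "snd s < n"
      using eventually_happens'[OF _ eventually_conj[OF ev_head[of "Suc k" N] eventually_gt_at_top[of "snd s"]]] by auto
    ultimately show "\<exists>s'. ((Suc k = 0 \<longrightarrow> fst s' = 0) \<and> head (Suc k) (fst s') (snd s')) \<and>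
        (fst s < fst s' \<and> snd s < snd s' \<and> tail k (snd s) (fst s'))"
      by (intro exI[of _ "(N, n)"]) simp
  qed
  then obtain s where s0: "fst (s 0) = 0" and s: "\<And>k. head k (fst (s k)) (snd (s k))"
    "\<And>k. fst (s k) < fst (s (Suc k))" "\<And>k. snd (s k) < snd (s (Suc k))"
    "\<And>k. tail k (snd (s k)) (fst (s (Suc k)))"
    by blast
  show thesis
  proof (rule that[of "\<lambda>k. fst (s k)" "\<lambda>k. snd (s k)"])
    show "AE t in M. (\<lambda>k. norm (basis_proj x (fst (s k)) (f (snd (s k)) t - g t))) \<longlonglongrightarrow> 0"
      by (rule AE_tendsto_0_of_fast_in_measure[OF borel_measurable_basis_proj_diff])
         (use s(1) in \<open>auto simp: head_def\<close>)
    show "AE t in M. (\<lambda>k. norm (f (snd (s k)) t - basis_proj x (fst (s (Suc k))) (f (snd (s k)) t))) \<longlonglongrightarrow> 0"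
      by (rule AE_tendsto_0_of_fast_in_measure[OF borel_measurable_remainder])
         (use s(4) in \<open>auto simp: tail_def\<close>)
  qed (use s s0 in \<open>auto intro: strict_monoI_Suc\<close>)
qed

text \<open>The subsequence is fixed before any functional is considered; only the weights
  \<open>a k\<close> and the null set depend on \<open>\<phi>\<close>.\<close>

lemma scalarly_ae_subsequence:
  assumes est: "\<And>B. blocking x B \<Longrightarrow> upper_estimate q B"
    and q: "1 < q" "1 / q + 1 / q' = 1"
    and C: "C \<ge> 0" "\<And>n. (\<integral>\<^sup>+t. ennreal (norm (f n t) powr enn2real q') \<partial>M) \<le> ennreal C"
  shows "\<exists>r. strict_mono r \<and> scalarly_ae M (\<lambda>n. f (r n)) g"
proof -
  obtain m r where m: "strict_mono m" "m 0 = 0" and "strict_mono r"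
    and head: "AE t in M. (\<lambda>k. norm (basis_proj x (m k) (f (r k) t - g t))) \<longlonglongrightarrow> 0"
    and tail: "AE t in M. (\<lambda>k. norm (f (r k) t - basis_proj x (m (Suc k)) (f (r k) t))) \<longlonglongrightarrow> 0"
    by (rule gliding_hump) blast
  have "AE t in M. (\<lambda>k. \<phi> (f (r k) t)) \<longlonglongrightarrow> \<phi> (g t)" for \<phi> :: "'a \<Rightarrow>\<^sub>L real"
  proof -
    define Q where "Q k v = basis_proj x (m (Suc k)) v - basis_proj x (m k) v" for k v
    obtain a where a: "\<And>k. 0 \<le> a k" "summable (\<lambda>k. a k powr enn2real q')"
      "\<And>k v. \<bar>\<phi> (Q k v)\<bar> \<le> a k * norm v"
      unfolding Q_def by (rule blocking_functional_bound[OF basis est q m, of \<phi>]) blast+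
    have r_pos: "enn2real q' > 0"
      using q by (cases rule: conjugate_exponent_cases) auto
    have norm_meas: "(\<lambda>t. norm (f n t)) \<in> borel_measurable M" for n
      by (rule strongly_measurable_continuous[OF f_meas]) (intro continuous_intros)
    have "AE t in M. (\<lambda>k. a k * norm (f (r k) t)) \<longlonglongrightarrow> 0"
      by (rule AE_tendsto_0_of_summable_powr[OF norm_meas r_pos a(2,1) C(1)]) (use C(2) in simp)
    with head tail show ?thesis
    proof eventually_elim
      case (elim t)
      have "(\<lambda>k. \<phi> (basis_proj x (m k) (f (r k) t - g t))) \<longlonglongrightarrow> \<phi> 0"
        by (rule blinfun.tendsto[OF tendsto_const tendsto_norm_zero_cancel[OF elim(1)]])
      moreover have "(\<lambda>k. \<phi> (f (r k) t - basis_proj x (m (Suc k)) (f (r k) t))) \<longlonglongrightarrow> \<phi> 0"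
        by (rule blinfun.tendsto[OF tendsto_const tendsto_norm_zero_cancel[OF elim(2)]])
      moreover have "(\<lambda>k. \<phi> (Q k (f (r k) t))) \<longlonglongrightarrow> 0"
        by (rule Lim_null_comparison[OF always_eventually elim(3)]) (use a(3) in simp)
      moreover have "(\<lambda>k. \<phi> (basis_proj x (m k) (g t))) \<longlonglongrightarrow> \<phi> (g t)"
        using LIMSEQ_subseq_LIMSEQ[OF basis_proj_tendsto[OF basis] m(1)]
        by (intro blinfun.tendsto[OF tendsto_const]) (simp add: o_def)
      \<comment> \<open>The four terms telescope to \<open>\<phi> (f (r k) t)\<close> by linearity:
        head difference, remainder, block, and partial expansion of \<open>g t\<close>.\<close>
      ultimately have "(\<lambda>k. \<phi> (basis_proj x (m k) (f (r k) t - g t))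
          + \<phi> (f (r k) t - basis_proj x (m (Suc k)) (f (r k) t))
          + \<phi> (Q k (f (r k) t)) + \<phi> (basis_proj x (m k) (g t))) \<longlonglongrightarrow> \<phi> 0 + \<phi> 0 + 0 + \<phi> (g t)"
        by (intro tendsto_add)
      then show ?case
        by (simp add: Q_def blinfun.diff_right linear_diff[OF linear_basis_proj[OF basis]] blinfun.zero_right)
    qed
  qed
  with \<open>strict_mono r\<close> show ?thesis
    unfolding scalarly_ae_def by blast
qed

end

theorem theorem4p5:
  fixes q q' :: ennreal and x :: "nat \<Rightarrow> 'a::banach"
  assumes "1 < q" and "1 / q + 1 / q' = 1"
    and "schauder_basis x"
    and "\<And>B. blocking x B \<Longrightarrow> upper_estimate q B"
  shows "\<forall>p. q' \<le> p \<longrightarrow> property_D TYPE('a) p"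
proof (intro allI impI)
  fix p assume "q' \<le> p"
  define r where "r = enn2real q'"
  \<comment> \<open>Since \<open>1 < q\<close>, the exponent \<open>q'\<close> is finite, so
    \<open>enn2real\<close> loses nothing and the moment bound applies with
    \<open>r\<close>.\<close>
  have r: "q' = ennreal r" "1 \<le> r"
    using assms(1,2) by (cases rule: conjugate_exponent_cases; simp add: r_def)+
  show "property_D TYPE('a) p"
    unfolding property_D_def
  proof (intro allI impI, elim conjE)
    fix f :: "nat \<Rightarrow> real \<Rightarrow> 'a" and g
    assume f: "Lp_bounded unit_interval p f"
      and g: "strongly_measurable unit_interval g" "scalarly_in_measure unit_interval f g"
    have "strongly_measurable unit_interval (f n)" for n
      using f by (simp add: Lp_bounded_def in_Lp_def)
    moreover obtain C where "C \<ge> 0"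
      "\<And>n. (\<integral>\<^sup>+t. ennreal (norm (f n t) powr r) \<partial>unit_interval) \<le> ennreal C"
      using Lp_bounded_moment[OF f, of r] r \<open>q' \<le> p\<close> by auto
    ultimately show "\<exists>r. strict_mono r \<and> scalarly_ae unit_interval (\<lambda>n. f (r n)) g"
      unfolding r_def
      by (intro scalarly_ae_subsequence[OF complete_measure_unit_interval finite_measure_unit_interval
            assms(3) _ g assms(4,1,2)])
  qed
qed

end
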